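(* Strongly separating locality relations on the lattice $G(\mathbb{R}^2)$ of linear subspaces of $\mathbb{R}^2$ are in one-one correspondence with involutive maps $\psi\colon[0,\pi)\to[0,\pi)$ without fixed points.
   Context: $G(\mathbb{R}^2)$ is ordered by inclusion; it is a bounded lattice with join $+$, meet $\cap$, least element $\{0\}$, greatest element $\mathbb{R}^2$. "Involutive" means $\psi\circ\psi=\mathrm{Id}$. For a bounded lattice $(L,\leq,0,1)$ with meet $\wedge$ and join $\vee$: for a symmetric binary relation $\top$ on $L$ and $A\subseteq L$, $A^\top:=\{x'\in L\mid x\,\top\,x'\text{ for all }x\in A\}$ and $a^\top:=\{a\}^\top$. A poset ideal is a subset $M$ of $L$ such that $a\in M$ and $b\leq a$ imply $b\in M$; a lattice ideal is a poset ideal closed under $\vee$. A locality relation on the lattice $L$ is a symmetric binary relation $\top$ on $L$ such that $a^\top$ is a lattice ideal for every $a\in L$. It is called strongly separating if (a) $a\,\top\,b\Rightarrow a\wedge b=0$ for all $a,b\in L$; (b) for every $a\in L$ the set $a^\top$ has a greatest element $\operatorname{grt}(a^\top)$; (c) $\operatorname{grt}((a^\top)^\top)=a$ for all $a\in L$, where $\operatorname{grt}$ denotes the greatest element. *)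

theory Defs
  imports "HOL-Analysis.Analysis"
begin

definition polar :: "('a \<Rightarrow> 'a \<Rightarrow> bool) \<Rightarrow> 'a set \<Rightarrow> 'a set" where
  "polar T A = {x'. \<forall>x\<in>A. T x x'}"

definition poset_ideal :: "'a::order set \<Rightarrow> bool" where
  "poset_ideal M \<longleftrightarrow> (\<forall>a b. a \<in> M \<and> b \<le> a \<longrightarrow> b \<in> M)"

definition lattice_ideal :: "'a::lattice set \<Rightarrow> bool" where
  "lattice_ideal M \<longleftrightarrow> poset_ideal M \<and> (\<forall>a\<in>M. \<forall>b\<in>M. sup a b \<in> M)"

definition locality_relation :: "('a::bounded_lattice \<Rightarrow> 'a \<Rightarrow> bool) \<Rightarrow> bool" where
  "locality_relation T \<longleftrightarrow> symp T \<and> (\<forall>a. lattice_ideal (polar T {a}))"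

text \<open>A predicate rather than a choice of greatest element, so that
  ``the greatest element of \<open>M\<close> is \<open>g\<close>'' includes the assertion that \<open>M\<close> has one.\<close>

definition is_grt :: "'a::order set \<Rightarrow> 'a \<Rightarrow> bool" where
  "is_grt M g \<longleftrightarrow> g \<in> M \<and> (\<forall>x\<in>M. x \<le> g)"

definition strongly_separating :: "('a::bounded_lattice \<Rightarrow> 'a \<Rightarrow> bool) \<Rightarrow> bool" where
  "strongly_separating T \<longleftrightarrow>
     (\<forall>a b. T a b \<longrightarrow> inf a b = bot) \<and>
     (\<forall>a. \<exists>g. is_grt (polar T {a}) g) \<and>
     (\<forall>a. is_grt (polar T (polar T {a})) a)"

typedef (overloaded) 'a linear_subspace = "{U :: 'a::real_vector set. subspace U}"
  by (auto intro: subspace_UNIV)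

setup_lifting type_definition_linear_subspace

instantiation linear_subspace :: (real_vector) bounded_lattice
begin

lift_definition less_eq_linear_subspace :: "'a linear_subspace \<Rightarrow> 'a linear_subspace \<Rightarrow> bool"
  is "(\<subseteq>)" .

lift_definition less_linear_subspace :: "'a linear_subspace \<Rightarrow> 'a linear_subspace \<Rightarrow> bool"
  is "(\<subset>)" .

lift_definition inf_linear_subspace :: "'a linear_subspace \<Rightarrow> 'a linear_subspace \<Rightarrow> 'a linear_subspace"
  is "(\<inter>)" by (rule subspace_inter)

lift_definition sup_linear_subspace :: "'a linear_subspace \<Rightarrow> 'a linear_subspace \<Rightarrow> 'a linear_subspace"
  is "\<lambda>U V. {u + v |u v. u \<in> U \<and> v \<in> V}" by (rule subspace_sums)

lift_definition bot_linear_subspace :: "'a linear_subspace" is "{0}" by (rule subspace_single_0)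

lift_definition top_linear_subspace :: "'a linear_subspace" is UNIV by (rule subspace_UNIV)

instance
proof
  fix x y z :: "'a linear_subspace"
  show "x \<le> sup x y"
    by transfer (force dest: subspace_0)
  show "y \<le> sup x y"
    by transfer (force dest: subspace_0)
  show "y \<le> x \<Longrightarrow> z \<le> x \<Longrightarrow> sup y z \<le> x"
    by transfer (auto intro: subspace_add)
  show "bot \<le> x"
    by transfer (auto dest: subspace_0)
qed (transfer; auto)+

end

text \<open>The one-dimensional subspaces of the plane are parametrised bijectively by their
  angle in \<open>[0, \<pi>)\<close> with the first coordinate axis.\<close>

lift_definition line_at :: "real \<Rightarrow> (real^2) linear_subspace"
  is "\<lambda>\<theta>. span {vector [cos \<theta>, sin \<theta>]}" by (rule subspace_span)

text \<open>Maps \<open>[0, \<pi>) \<rightarrow> [0, \<pi>)\<close> are taken extensional, so that equality of maps is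
  agreement on \<open>[0, \<pi>)\<close>.\<close>

definition fixfree_involutions :: "(real \<Rightarrow> real) set" where
  "fixfree_involutions =
     {\<psi> \<in> {0..<pi} \<rightarrow>\<^sub>E {0..<pi}. \<forall>\<theta>\<in>{0..<pi}. \<psi> (\<psi> \<theta>) = \<theta> \<and> \<psi> \<theta> \<noteq> \<theta>}"

end

theory Submission imports Defs begin

text \<open>
  On any bounded lattice a strongly separating locality relation \<open>T\<close> is the same thing as an
  orthocomplementation \<open>c\<close>, an antitone involution with \<open>a \<sqinter> c a = \<bottom>\<close>.  Indeed the ideal
  \<open>a\<^sup>T\<close> is principal, so it is the set of elements below its greatest element \<open>c a\<close>, that is,
  \<open>T a b \<longleftrightarrow> b \<le> c a\<close>; symmetry of \<open>T\<close> then makes \<open>c\<close> a Galois connection with itself, and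
  the double polar condition says that \<open>c\<close> is its own inverse
  (\<open>strongly_separating_iff_orthocomplementation\<close>).

  The lattice of subspaces of the plane consists of \<open>\<bottom>\<close>, \<open>\<top>\<close> and pairwise incomparable
  elements in between, the lines.  An orthocomplementation of such a lattice has to exchange
  \<open>\<bottom>\<close> and \<open>\<top>\<close>, so it permutes the lines (\<open>orthocomplementation_on_atoms\<close>), and
  \<open>a \<sqinter> c a = \<bottom>\<close> says precisely that no line is fixed (\<open>on_atoms_fixfree_involution\<close>).  Conversely every fixed-point-free involution of
  the lines extends to an orthocomplementation, since apart from \<open>\<bottom>\<close> and \<open>\<top>\<close> there are no
  comparabilities to be reversed (\<open>orthocomplementation_extension\<close>).  Each line
  has a unique angle in \<open>[0, \<pi>)\<close>, which turns involutions of the lines into involutions of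
  the interval.
\<close>

section \<open>Strongly separating locality relations and orthocomplementations\<close>

definition orthocomplementation :: "('a::bounded_lattice \<Rightarrow> 'a) \<Rightarrow> bool" where
  "orthocomplementation c \<longleftrightarrow>
     antimono c \<and> (\<forall>a. c (c a) = a) \<and> (\<forall>a. inf a (c a) = bot)"

lemma is_grt_atMost: "is_grt {..a} b \<longleftrightarrow> b = a"
  unfolding is_grt_def by (auto intro: order_antisym)

text \<open>An antitone involution is self-adjoint, which is the symmetry of the relation
  \<open>b \<le> c a\<close>.\<close>

lemma orthocomplementation_galois:
  assumes "orthocomplementation c"
  shows "b \<le> c a \<longleftrightarrow> a \<le> c b"
  using assms unfolding orthocomplementation_def by (metis antimonoD)

lemma polar_orthocomplementation:
  assumes "T = (\<lambda>a b. b \<le> c a)"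
  shows "polar T {a} = {..c a}"
  unfolding polar_def assms by auto

lemma double_polar_orthocomplementation:
  assumes c: "orthocomplementation c" and T: "T = (\<lambda>a b. b \<le> c a)"
  shows "polar T (polar T {a}) = {..a}"
proof -
  have "polar T (polar T {a}) = {x. c a \<le> c x}"
    unfolding polar_orthocomplementation[OF T] unfolding polar_def T
    using orthocomplementation_galois[OF c]
    by (intro Collect_cong) (metis atMost_iff order_refl order_trans)
  also have "\<dots> = {..a}"
    using orthocomplementation_galois[OF c] c by (auto simp: orthocomplementation_def)
  finally show ?thesis .
qed

lemma orthocomplementation_imp_strongly_separating:
  assumes c: "orthocomplementation c" and T: "T = (\<lambda>a b. b \<le> c a)"
  shows "locality_relation T \<and> strongly_separating T"
proof
  have "symp T"
    using orthocomplementation_galois[OF c] unfolding T by (auto intro: sympI)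
  moreover have "lattice_ideal {..c a}" for a
    unfolding lattice_ideal_def poset_ideal_def by (auto intro: order_trans)
  ultimately show "locality_relation T"
    unfolding locality_relation_def polar_orthocomplementation[OF T] by blast
  have "inf a b = bot" if "b \<le> c a" for a b
    using c inf_mono[OF order_refl that] unfolding orthocomplementation_def
    by (metis bot.extremum_uniqueI)
  then show "strongly_separating T"
    unfolding strongly_separating_def double_polar_orthocomplementation[OF c T]
    unfolding polar_orthocomplementation[OF T] is_grt_atMost by (simp add: T)
qed

lemma strongly_separating_imp_orthocomplementation:
  assumes loc: "locality_relation T" and sep: "strongly_separating T"
  obtains c where "orthocomplementation c" "T = (\<lambda>a b. b \<le> c a)"
proof -
  obtain c where c: "\<And>a. is_grt (polar T {a}) (c a)"
    using sep unfolding strongly_separating_def by metis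
  have sym: "T a b \<longleftrightarrow> T b a" for a b
    using loc unfolding locality_relation_def by (auto dest: sympD)
  have T: "T a b \<longleftrightarrow> b \<le> c a" for a b
    using loc c[of a]
    unfolding locality_relation_def lattice_ideal_def poset_ideal_def is_grt_def polar_def
    by auto
  have galois: "b \<le> c a \<longleftrightarrow> a \<le> c b" for a b
    using sym T by blast
  have "antimono c"
    by (rule antimonoI) (meson galois order_refl order_trans)
  moreover have "c (c a) = a" for a
  proof (rule order_antisym)
    show "a \<le> c (c a)" using galois by blast
    have "c (c a) \<in> polar T (polar T {a})"
      unfolding polar_def by (simp add: T) (metis galois order_refl order_trans)
    then show "c (c a) \<le> a"
      using sep unfolding strongly_separating_def is_grt_def by blast
  qed
  moreover have "inf a (c a) = bot" for a
    using sep T unfolding strongly_separating_def by blast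
  ultimately show thesis
    using that T unfolding orthocomplementation_def by blast
qed

theorem strongly_separating_iff_orthocomplementation:
  "locality_relation T \<and> strongly_separating T \<longleftrightarrow>
     (\<exists>c. orthocomplementation c \<and> T = (\<lambda>a b. b \<le> c a))"
proof
  assume T: "locality_relation T \<and> strongly_separating T"
  obtain c where "orthocomplementation c" "T = (\<lambda>a b. b \<le> c a)"
    by (rule strongly_separating_imp_orthocomplementation[OF T[THEN conjunct1] T[THEN conjunct2]])
  then show "\<exists>c. orthocomplementation c \<and> T = (\<lambda>a b. b \<le> c a)"
    by (intro exI[of _ c] conjI)
next
  assume "\<exists>c. orthocomplementation c \<and> T = (\<lambda>a b. b \<le> c a)"
  then show "locality_relation T \<and> strongly_separating T"
    by (elim exE conjE) (rule orthocomplementation_imp_strongly_separating)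
qed

lemma orthocomplementation_bot_top:
  assumes "orthocomplementation c"
  shows "c bot = top" "c top = bot"
proof -
  have "inf top (c top) = bot" and "c (c top) = top"
    using assms unfolding orthocomplementation_def by auto
  then show "c top = bot" "c bot = top" by simp_all
qed

section \<open>Lattices of height two\<close>

text \<open>Bounded lattices made of a least element, a greatest element and an antichain in between
  that is indexed injectively by a set.\<close>

locale height_two_lattice =
  fixes I :: "'i set" and atom :: "'i \<Rightarrow> 'a::bounded_lattice"
  assumes cases: "x = bot \<or> x = top \<or> x \<in> atom ` I"
    and antichain: "\<lbrakk>i \<in> I; j \<in> I; atom i \<le> atom j\<rbrakk> \<Longrightarrow> i = j"
    and atom_not_bot: "i \<in> I \<Longrightarrow> atom i \<noteq> bot"
    and atom_not_top: "i \<in> I \<Longrightarrow> atom i \<noteq> top"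
begin

lemma inj_atom: "inj_on atom I"
  by (rule inj_onI) (simp add: antichain)

lemma inf_distinct_atoms:
  assumes "i \<in> I" "j \<in> I" "i \<noteq> j"
  shows "inf (atom i) (atom j) = bot"
  using cases[of "inf (atom i) (atom j)"]
proof (elim disjE)
  assume "inf (atom i) (atom j) = top"
  then show ?thesis
    using atom_not_top[OF assms(1)] by (metis inf_le1 top.extremum_uniqueI)
next
  assume "inf (atom i) (atom j) \<in> atom ` I"
  then obtain k where "k \<in> I" "atom k = inf (atom i) (atom j)" by auto
  then have "k = i" "k = j"
    using assms antichain by (metis inf_le1, metis inf_le2)
  then show ?thesis using assms by simp
qed

text \<open>An orthocomplementation exchanges \<open>\<bottom>\<close> and \<open>\<top>\<close> and is injective, so it cannot map an
  atom to either of them.\<close>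

lemma orthocomplementation_on_atoms:
  assumes c: "orthocomplementation c" and i: "i \<in> I"
  shows "\<exists>j\<in>I. c (atom i) = atom j"
proof -
  have inv: "\<And>a. c (c a) = a" using c unfolding orthocomplementation_def by blast
  have "c (atom i) \<noteq> bot" "c (atom i) \<noteq> top"
    using orthocomplementation_bot_top[OF c] atom_not_bot[OF i] atom_not_top[OF i] inv by metis+
  then show ?thesis using cases[of "c (atom i)"] by blast
qed

definition on_atoms :: "('a \<Rightarrow> 'a) \<Rightarrow> 'i \<Rightarrow> 'i" where
  "on_atoms c = restrict (\<lambda>i. inv_into I atom (c (atom i))) I"

lemma on_atoms:
  assumes "orthocomplementation c" "i \<in> I"
  shows "on_atoms c i \<in> I" "atom (on_atoms c i) = c (atom i)"
  using orthocomplementation_on_atoms[OF assms] inj_atom assms(2)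
  unfolding on_atoms_def by auto

lemma on_atoms_eqI:
  assumes "i \<in> I" "j \<in> I" "c (atom i) = atom j"
  shows "on_atoms c i = j"
  using assms inj_atom unfolding on_atoms_def by simp

lemma on_atoms_fixfree_involution:
  assumes c: "orthocomplementation c" and i: "i \<in> I"
  shows "on_atoms c (on_atoms c i) = i" "on_atoms c i \<noteq> i"
proof -
  show "on_atoms c (on_atoms c i) = i"
    using on_atoms[OF c i] i c by (intro on_atoms_eqI) (auto simp: orthocomplementation_def)
  show "on_atoms c i \<noteq> i"
  proof
    assume "on_atoms c i = i"
    then have "inf (atom i) (c (atom i)) = atom i"
      using on_atoms(2)[OF c i] by simp
    then show False
      using c atom_not_bot[OF i] unfolding orthocomplementation_def by simp
  qed
qed

lemma orthocomplementation_eqI: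
  assumes c: "orthocomplementation c" and d: "orthocomplementation d"
    and eq: "on_atoms c = on_atoms d"
  shows "c = d"
proof
  fix x
  show "c x = d x"
    using cases[of x] orthocomplementation_bot_top[OF c] orthocomplementation_bot_top[OF d]
      on_atoms(2)[OF c] on_atoms(2)[OF d] eq
    by (auto simp: image_iff)
qed

text \<open>The extension exchanges \<open>\<bottom>\<close> and \<open>\<top>\<close>.  It is automatically antitone because atoms are
  comparable only to \<open>\<bottom>\<close>, \<open>\<top>\<close> and themselves.\<close>

lemma orthocomplementation_extension:
  assumes maps: "\<And>i. i \<in> I \<Longrightarrow> \<psi> i \<in> I"
    and inv: "\<And>i. i \<in> I \<Longrightarrow> \<psi> (\<psi> i) = i"
    and fixfree: "\<And>i. i \<in> I \<Longrightarrow> \<psi> i \<noteq> i"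
  shows "\<exists>c. orthocomplementation c \<and> (\<forall>i\<in>I. on_atoms c i = \<psi> i)"
proof -
  define c where
    "c x = (if x = bot then top else if x = top then bot else atom (\<psi> (inv_into I atom x)))" for x
  have c_atom: "c (atom i) = atom (\<psi> i)" if "i \<in> I" for i
    using that inj_atom atom_not_bot atom_not_top unfolding c_def by simp
  have c_bot: "c bot = top" unfolding c_def by simp
  \<comment> \<open>If \<open>\<bottom> = \<top>\<close>, the first branch of the definition applies to \<open>\<top>\<close>, with the same value.\<close>
  have c_top: "c top = bot" unfolding c_def by auto
  have "c y \<le> c x" if "x \<le> y" for x y
    using cases[of x] cases[of y] that
    by (elim disjE imageE) (auto simp: c_bot c_top c_atom bot_unique top_unique antichain
        atom_not_bot atom_not_top dest: antichain)
  moreover have "c (c x) = x" for x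
    using cases[of x] by (auto simp: c_bot c_top c_atom maps inv)
  moreover have "inf x (c x) = bot" for x
    using cases[of x] inf_distinct_atoms[OF _ maps fixfree[symmetric]]
    by (auto simp: c_bot c_top c_atom)
  ultimately have "orthocomplementation c"
    unfolding orthocomplementation_def by (auto intro: antimonoI)
  moreover have "\<forall>i\<in>I. on_atoms c i = \<psi> i"
    by (simp add: on_atoms_eqI maps c_atom)
  ultimately show ?thesis by blast
qed

text \<open>For a strongly separating locality relation \<open>T\<close> the function passed to \<open>on_atoms\<close> is the
  orthocomplementation that corresponds to \<open>T\<close>.\<close>

definition polar_index :: "('a \<Rightarrow> 'a \<Rightarrow> bool) \<Rightarrow> 'i \<Rightarrow> 'i" where
  "polar_index T = on_atoms (\<lambda>a. THE g. is_grt (polar T {a}) g)"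

lemma polar_index_orthocomplementation: "polar_index (\<lambda>a b. b \<le> c a) = on_atoms c"
  unfolding polar_index_def polar_orthocomplementation[OF refl] is_grt_atMost by simp

lemma is_grt_polar_index:
  assumes "locality_relation T" "strongly_separating T" "i \<in> I"
  shows "is_grt (polar T {atom i}) (atom (polar_index T i))"
proof -
  obtain c where c: "orthocomplementation c" "T = (\<lambda>a b. b \<le> c a)"
    by (rule strongly_separating_imp_orthocomplementation[OF assms(1,2)])
  show ?thesis
    unfolding c(2) polar_index_orthocomplementation
    by (simp add: polar_orthocomplementation[OF refl] is_grt_atMost on_atoms c(1) assms(3))
qed

theorem bij_betw_polar_index:
  "bij_betw polar_index {T. locality_relation T \<and> strongly_separating T}
     {\<psi> \<in> I \<rightarrow>\<^sub>E I. \<forall>i\<in>I. \<psi> (\<psi> i) = i \<and> \<psi> i \<noteq> i}" (is "bij_betw _ ?A ?B")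
  unfolding bij_betw_def
proof
  have A: "?A = (\<lambda>c a b. b \<le> c a) ` {c. orthocomplementation c}"
    by (rule set_eqI)
      (simp only: mem_Collect_eq strongly_separating_iff_orthocomplementation image_iff Bex_def)
  have inj: "inj_on on_atoms {c. orthocomplementation c}"
    by (rule inj_onI) (simp add: orthocomplementation_eqI)
  show "inj_on polar_index ?A"
    unfolding A by (rule inj_on_imageI) (simp add: comp_def polar_index_orthocomplementation inj)
  have maps: "on_atoms c \<in> ?B" if "orthocomplementation c" for c
  proof -
    have "on_atoms c \<in> extensional I" by (simp add: on_atoms_def)
    then show ?thesis
      using on_atoms[OF that] on_atoms_fixfree_involution[OF that] by (simp add: PiE_iff)
  qed
  have onto: "\<psi> \<in> on_atoms ` {c. orthocomplementation c}" if \<psi>: "\<psi> \<in> ?B" for \<psi>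
  proof -
    have \<psi>_props: "\<psi> i \<in> I" "\<psi> (\<psi> i) = i" "\<psi> i \<noteq> i" if "i \<in> I" for i
      using \<psi> that by (simp_all add: PiE_iff)
    have "\<exists>c. orthocomplementation c \<and> (\<forall>i\<in>I. on_atoms c i = \<psi> i)"
      by (rule orthocomplementation_extension) (simp_all add: \<psi>_props)
    then obtain c where c: "orthocomplementation c" "\<forall>i\<in>I. on_atoms c i = \<psi> i"
      by blast
    have "on_atoms c \<in> extensional I" "\<psi> \<in> extensional I"
      using \<psi> by (simp_all add: on_atoms_def PiE_iff)
    then have "\<psi> = on_atoms c"
      using c(2) by (intro extensionalityI[of _ I]) simp_all
    then show ?thesis
      using c(1) by (simp only: image_eqI mem_Collect_eq)
  qed
  show "polar_index ` ?A = ?B"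
    unfolding A image_image polar_index_orthocomplementation
  proof
    show "on_atoms ` {c. orthocomplementation c} \<subseteq> ?B"
      by (rule image_subsetI) (rule maps, simp)
    show "?B \<subseteq> on_atoms ` {c. orthocomplementation c}"
      by (rule subsetI) (rule onto)
  qed
qed

end

section \<open>Subspaces of the plane\<close>

lemma direction_not_zero: "(vector [cos \<theta>, sin \<theta>] :: real^2) \<noteq> 0"
proof
  assume "(vector [cos \<theta>, sin \<theta>] :: real^2) = 0"
  then have "cos \<theta> = 0" "sin \<theta> = 0"
    by (metis vector_2 zero_index)+
  then show False
    using sin_cos_squared_add[of \<theta>] by (simp del: sin_cos_squared_add)
qed

lemma dim_line: "dim (span {vector [cos \<theta>, sin \<theta>] :: real^2}) = 1"
  using direction_not_zero[of \<theta>] by simp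

text \<open>A vector in the upper half-plane has a polar angle in \<open>[0, \<pi>]\<close>; one in the lower
  half-plane spans the same line as its negative.\<close>

lemma exists_direction:
  fixes v :: "real^2"
  shows "\<exists>\<theta>\<in>{0..<pi}. v \<in> span {vector [cos \<theta>, sin \<theta>]}"
proof -
  have upper: "\<exists>\<theta>\<in>{0..<pi}. v \<in> span {vector [cos \<theta>, sin \<theta>]}"
    if v: "v $ 2 \<ge> 0" "v \<noteq> 0" for v :: "real^2"
  proof -
    have n: "norm v > 0" "(norm v)\<^sup>2 = (v $ 1)\<^sup>2 + (v $ 2)\<^sup>2"
      using v(2) by (simp, simp add: norm_vec_def L2_set_def sum_2)
    have "(v $ 1 / norm v)\<^sup>2 + (v $ 2 / norm v)\<^sup>2 = 1"
      using n(1) by (simp add: power_divide n(2)[symmetric] flip: add_divide_distrib)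
    then obtain t where t: "0 \<le> t" "t \<le> pi" "v $ 1 / norm v = cos t" "v $ 2 / norm v = sin t"
      using sincos_total_pi[of "v $ 2 / norm v" "v $ 1 / norm v"] v(1) n(1) by auto
    have v_t: "v = norm v *\<^sub>R vector [cos t, sin t]"
      using n(1) by (simp add: vec_eq_iff forall_2 flip: t(3,4))
    show ?thesis
    proof (cases "t = pi")
      case True
      \<comment> \<open>The half-open interval represents the negative first axis by the angle \<open>0\<close>.\<close>
      then have "v = (- norm v) *\<^sub>R vector [cos 0, sin 0]"
        by (subst v_t) (simp add: vec_eq_iff forall_2)
      then have "v \<in> span {vector [cos 0, sin 0]}"
        unfolding span_singleton by (rule range_eqI)
      then show ?thesis by (intro bexI[of _ 0]) auto
    next
      case False
      then show ?thesis
        using t v_t by (intro bexI[of _ t]) (auto simp: span_singleton)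
    qed
  qed
  show ?thesis
  proof (cases "v = 0")
    case True
    then show ?thesis by (auto intro!: bexI[of _ 0] span_zero)
  next
    case False
    show ?thesis
    proof (cases "v $ 2 \<ge> 0")
      case True
      then show ?thesis using upper False by blast
    next
      case 2: False
      then obtain \<theta> where "\<theta> \<in> {0..<pi}" "- v \<in> span {vector [cos \<theta>, sin \<theta>]}"
        using upper[of "- v"] False by auto
      then show ?thesis by (metis span_neg minus_minus)
    qed
  qed
qed

lemma subspace_plane_cases:
  fixes U :: "(real^2) set"
  assumes U: "subspace U"
  shows "U = {0} \<or> U = UNIV \<or> (\<exists>\<theta>\<in>{0..<pi}. U = span {vector [cos \<theta>, sin \<theta>]})"
proof -
  consider "dim U = 0" | "dim U = 1" | "dim U = 2"
    using dim_subset_UNIV[of U] by fastforce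
  then show ?thesis
  proof cases
    case 1
    then show ?thesis using subspace_0[OF U] by auto
  next
    case 2
    then obtain v where v: "v \<in> U" "v \<noteq> 0" by (metis dim_eq_0 subsetI singleton_iff zero_neq_one)
    obtain \<theta> where \<theta>: "\<theta> \<in> {0..<pi}" "v \<in> span {vector [cos \<theta>, sin \<theta>]}"
      using exists_direction by blast
    \<comment> \<open>Both \<open>U\<close> and the line at angle \<open>\<theta>\<close> have dimension one and contain \<open>v\<close>.\<close>
    have "span {v} = U"
      using v U 2 by (intro subspace_dim_equal) (auto simp: span_minimal)
    moreover have "span {v} = span {vector [cos \<theta>, sin \<theta>]}"
      using v \<theta> dim_line[of \<theta>] by (intro subspace_dim_equal) (auto simp: span_minimal)
    ultimately show ?thesis using \<theta>(1) by blast
  next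
    case 3
    then have "U = UNIV" using U dim_eq_full[of U] by (simp add: span_eq_iff[THEN iffD2])
    then show ?thesis by blast
  qed
qed

text \<open>Parallel unit vectors at angles \<open>\<theta>\<close> and \<open>\<phi>\<close> have determinant \<open>sin (\<phi> - \<theta>) = 0\<close>, and the
  sine has no zero other than \<open>0\<close> in \<open>(-\<pi>, \<pi>)\<close>.\<close>

lemma angle_unique:
  assumes "\<theta> \<in> {0..<pi}" "\<phi> \<in> {0..<pi}"
    and "span {vector [cos \<theta>, sin \<theta>] :: real^2} \<subseteq> span {vector [cos \<phi>, sin \<phi>]}"
  shows "\<theta> = \<phi>"
proof -
  have "(vector [cos \<theta>, sin \<theta>] :: real^2) \<in> span {vector [cos \<phi>, sin \<phi>]}"
    by (rule subsetD[OF assms(3) span_base]) simp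
  then obtain k where "(vector [cos \<theta>, sin \<theta>] :: real^2) = k *\<^sub>R vector [cos \<phi>, sin \<phi>]"
    unfolding span_singleton by (rule rangeE)
  then have k: "cos \<theta> = k * cos \<phi>" "sin \<theta> = k * sin \<phi>"
    by (simp_all add: vec_eq_iff forall_2)
  have "sin (\<phi> - \<theta>) = 0"
    unfolding sin_diff k by (rule eq_iff_diff_eq_0[THEN iffD1]) (simp only: ac_simps)
  then have "\<phi> - \<theta> = 0"
    by (rule sin_eq_0_pi[rotated 2]) (use assms(1,2) in simp_all)
  then show ?thesis by simp
qed

interpretation plane: height_two_lattice "{0..<pi}" line_at
proof
  fix x :: "(real^2) linear_subspace"
  show "x = bot \<or> x = top \<or> x \<in> line_at ` {0..<pi}"
    unfolding image_iff by transfer (rule subspace_plane_cases)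
next
  fix i j :: real
  assume "i \<in> {0..<pi}" "j \<in> {0..<pi}" "line_at i \<le> line_at j"
  then show "i = j"
    by (intro angle_unique) (auto simp: less_eq_linear_subspace.rep_eq line_at.rep_eq)
next
  fix i :: real
  show "line_at i \<noteq> bot"
  proof transfer
    fix i :: real
    show "span {vector [cos i, sin i] :: real^2} \<noteq> {0}"
      using dim_line[of i] by (metis dim_eq_0 order_refl zero_neq_one)
  qed
  show "line_at i \<noteq> top"
  proof transfer
    fix i :: real
    show "span {vector [cos i, sin i] :: real^2} \<noteq> UNIV"
      using dim_line[of i] by (auto simp del: dim_span)
  qed
qed

theorem corollary5p17:
  "\<exists>\<Phi>. bij_betw \<Phi>
          {T :: (real^2) linear_subspace \<Rightarrow> (real^2) linear_subspace \<Rightarrow> bool.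
             locality_relation T \<and> strongly_separating T}
          fixfree_involutions \<and>
        (\<forall>T. locality_relation T \<and> strongly_separating T \<longrightarrow>
          (\<forall>\<theta>\<in>{0..<pi}. is_grt (polar T {line_at \<theta>}) (line_at (\<Phi> T \<theta>))))"
  unfolding fixfree_involutions_def
  by (intro exI[of _ plane.polar_index] conjI allI impI ballI plane.bij_betw_polar_index)
    (auto intro: plane.is_grt_polar_index)

end
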